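(* Let $V=V^{(1)}\otimes\cdots\otimes V^{(d)}$ be a tensor product of finite dimensional complex Hilbert spaces. For all tensors $S,T\in V$ we have $$|\langle T,S\rangle|\leq \|T\|_\star\,[S].$$
   Context: $V$ carries the Hilbert space structure with $\langle v^{(1)}\otimes\cdots\otimes v^{(d)},w^{(1)}\otimes\cdots\otimes w^{(d)}\rangle=\prod_e\langle v^{(e)},w^{(e)}\rangle$. A pure tensor in $V$ is an element of the form $v^{(1)}\otimes\cdots\otimes v^{(d)}$ with $v^{(e)}\in V^{(e)}$. The nuclear norm $\|T\|_\star$ of $T\in V$ is the smallest possible value of $\sum_{i=1}^m\|v_i\|$ over all decompositions $T=\sum_{i=1}^m v_i$ ($m$ arbitrary) into pure tensors $v_i$. The spectral norm $[S]$ of $S\in V$ is the maximum of $|\langle S,u\rangle|$ over all pure tensors $u\in V$ of unit length. *)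

theory Defs
  imports "HOL-Analysis.Analysis" "HOL-Library.FuncSet"
begin

(* The space is a linear subspace H of an ambient complex vector space (smul gives the scalar
   multiplication), so that a whole family of Hilbert spaces of different dimensions can live in
   one type; the inner product ip is only relevant on H.  It is linear in the first argument.
   Completeness is automatic in finite dimension. *)
locale fin_dim_hilbert = vector_space smul
  for smul :: "complex \<Rightarrow> 'a::ab_group_add \<Rightarrow> 'a" +
  fixes H :: "'a set" and ip :: "'a \<Rightarrow> 'a \<Rightarrow> complex"
  assumes subspace_H: "subspace H"
    and finite_dim: "\<exists>B. finite B \<and> span B = H"
    and ip_add_left: "\<lbrakk>x \<in> H; y \<in> H; z \<in> H\<rbrakk> \<Longrightarrow> ip (x + y) z = ip x z + ip y z"
    and ip_scale_left: "\<lbrakk>x \<in> H; y \<in> H\<rbrakk> \<Longrightarrow> ip (smul c x) y = c * ip x y"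
    and ip_cnj_sym: "\<lbrakk>x \<in> H; y \<in> H\<rbrakk> \<Longrightarrow> ip y x = cnj (ip x y)"
    and ip_pos: "\<lbrakk>x \<in> H; x \<noteq> 0\<rbrakk> \<Longrightarrow> 0 < Re (ip x x)"

definition hnorm :: "('a \<Rightarrow> 'a \<Rightarrow> complex) \<Rightarrow> 'a \<Rightarrow> real" where
  "hnorm ip x = sqrt (Re (ip x x))"

definition tuples :: "nat \<Rightarrow> (nat \<Rightarrow> 'a set) \<Rightarrow> (nat \<Rightarrow> 'a) set" where
  "tuples d H = (\<Pi>\<^sub>E e\<in>{1..d}. H e)"

definition multilinear_on ::
  "nat \<Rightarrow> (complex \<Rightarrow> 'a::ab_group_add \<Rightarrow> 'a) \<Rightarrow> (nat \<Rightarrow> 'a set) \<Rightarrow>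
   (complex \<Rightarrow> 'b::ab_group_add \<Rightarrow> 'b) \<Rightarrow> ((nat \<Rightarrow> 'a) \<Rightarrow> 'b) \<Rightarrow> bool" where
  "multilinear_on d smul H smul' f \<longleftrightarrow>
     (\<forall>v\<in>tuples d H. \<forall>e\<in>{1..d}. \<forall>x\<in>H e. \<forall>y\<in>H e.
        f (v(e := x + y)) = f (v(e := x)) + f (v(e := y))) \<and>
     (\<forall>v\<in>tuples d H. \<forall>e\<in>{1..d}. \<forall>x\<in>H e. \<forall>c.
        f (v(e := smul c x)) = smul' c (f (v(e := x))))"

(* V is the tensor product of the factors H 1, ..., H d as a vector space, with
   tensor (v 1, ..., v d) in the role of the pure tensor of v 1, ..., v d.  In the universal
   property it is enough to ask for scalar-valued multilinear maps f (other targets follow by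
   expanding in a basis); F is taken linear on the ambient space, which is no restriction since
   linear maps extend from subspaces, and uniqueness of F on V is the spanning condition. *)
locale tensor_product =
  fixes d :: nat
    and smul :: "complex \<Rightarrow> 'a::ab_group_add \<Rightarrow> 'a" and H :: "nat \<Rightarrow> 'a set"
    and smulV :: "complex \<Rightarrow> 'v::ab_group_add \<Rightarrow> 'v" and V :: "'v set"
    and tensor :: "(nat \<Rightarrow> 'a) \<Rightarrow> 'v"
  assumes tensor_multilinear: "multilinear_on d smul H smulV tensor"
    and tensor_span: "module.span smulV (tensor ` tuples d H) = V"
    and tensor_universal: "multilinear_on d smul H (*) f \<Longrightarrow>
      \<exists>F. Vector_Spaces.linear smulV (*) F \<and> (\<forall>v\<in>tuples d H. F (tensor v) = f v)"

locale hilbert_tensor_product = tensor_product d smul H smulV V tensor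
  for d :: nat
    and smul :: "complex \<Rightarrow> 'a::ab_group_add \<Rightarrow> 'a" and H :: "nat \<Rightarrow> 'a set"
    and smulV :: "complex \<Rightarrow> 'v::ab_group_add \<Rightarrow> 'v" and V :: "'v set"
    and tensor :: "(nat \<Rightarrow> 'a) \<Rightarrow> 'v" +
  fixes ip :: "nat \<Rightarrow> 'a \<Rightarrow> 'a \<Rightarrow> complex" and ipV :: "'v \<Rightarrow> 'v \<Rightarrow> complex"
  assumes factor_hilbert: "e \<in> {1..d} \<Longrightarrow> fin_dim_hilbert smul (H e) (ip e)"
    and product_hilbert: "fin_dim_hilbert smulV V ipV"
    and ip_tensor: "\<lbrakk>v \<in> tuples d H; w \<in> tuples d H\<rbrakk> \<Longrightarrow>
      ipV (tensor v) (tensor w) = (\<Prod>e\<in>{1..d}. ip e (v e) (w e))"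

definition pure_tensors :: "nat \<Rightarrow> (nat \<Rightarrow> 'a set) \<Rightarrow> ((nat \<Rightarrow> 'a) \<Rightarrow> 'v) \<Rightarrow> 'v set" where
  "pure_tensors d H tensor = tensor ` tuples d H"

(* P is the set of pure tensors.  By compactness the infimum and the supremum below are attained,
   except that there are no pure tensors of unit length when some factor is the zero space;
   the spectral norm is then an unspecified real number, but the only tensor is 0. *)
definition nuclear_norm ::
  "('v::ab_group_add \<Rightarrow> 'v \<Rightarrow> complex) \<Rightarrow> 'v set \<Rightarrow> 'v \<Rightarrow> real" where
  "nuclear_norm ipV P T =
     Inf {(\<Sum>i<m. hnorm ipV (u i)) | (m::nat) u. (\<forall>i<m. u i \<in> P) \<and> T = (\<Sum>i<m. u i)}"

definition spectral_norm :: "('v \<Rightarrow> 'v \<Rightarrow> complex) \<Rightarrow> 'v set \<Rightarrow> 'v \<Rightarrow> real" where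
  "spectral_norm ipV P S = Sup {cmod (ipV S u) | u. u \<in> P \<and> hnorm ipV u = 1}"

end

(* A decomposition of T into pure tensors u i bounds |<T,S>| by the sum of the |<u i,S>|, and
   homogeneity bounds each term by the norm of u i times the spectral norm of S; now pass to the
   infimum over all decompositions.  If there is no pure tensor of unit length, then T = 0. *)
theory Submission
  imports Defs
begin

context fin_dim_hilbert
begin

lemma ip_zero_left: "x \<in> H \<Longrightarrow> ip 0 x = 0"
  using ip_scale_left[of x x 0] by simp

lemma ip_zero_right: "x \<in> H \<Longrightarrow> ip x 0 = 0"
  using ip_cnj_sym[of 0 x] ip_zero_left subspace_0[OF subspace_H] by simp

lemma ip_diff_scale_left:
  assumes "x \<in> H" "y \<in> H" "z \<in> H"
  shows "ip (x - smul c y) z = ip x z - c * ip y z"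
  using ip_add_left[of x "smul (- c) y" z] ip_scale_left[of y z "- c"] assms
    subspace_scale[OF subspace_H, of y "- c"]
  by simp

lemma ip_scale_right:
  assumes "x \<in> H" "y \<in> H"
  shows "ip x (smul c y) = cnj c * ip x y"
proof -
  have "ip x (smul c y) = cnj (ip (smul c y) x)"
    using assms by (intro ip_cnj_sym subspace_scale[OF subspace_H])
  also have "\<dots> = cnj c * cnj (ip y x)"
    using assms by (simp add: ip_scale_left)
  also have "cnj (ip y x) = ip x y"
    using assms by (simp add: ip_cnj_sym[of y x])
  finally show ?thesis .
qed

lemma cmod_ip_commute: "\<lbrakk>x \<in> H; y \<in> H\<rbrakk> \<Longrightarrow> cmod (ip x y) = cmod (ip y x)"
  by (metis complex_mod_cnj ip_cnj_sym)

lemma Re_ip_self_nonneg: "x \<in> H \<Longrightarrow> 0 \<le> Re (ip x x)"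
  using ip_pos[of x] ip_zero_left[of x] by (cases "x = 0") auto

lemma ip_self_eq_of_real: "x \<in> H \<Longrightarrow> ip x x = of_real (Re (ip x x))"
  using ip_cnj_sym[of x x] by (simp add: complex_eq_iff)

lemma hnorm_zero: "hnorm ip 0 = 0"
  using ip_zero_left[OF subspace_0[OF subspace_H]] by (simp add: hnorm_def)

lemma hnorm_pos: "\<lbrakk>x \<in> H; x \<noteq> 0\<rbrakk> \<Longrightarrow> 0 < hnorm ip x"
  by (simp add: hnorm_def ip_pos)

lemma hnorm_scale:
  assumes "x \<in> H"
  shows "hnorm ip (smul c x) = cmod c * hnorm ip x"
proof -
  have "ip (smul c x) (smul c x) = (c * cnj c) * ip x x"
    using assms by (simp add: ip_scale_left ip_scale_right subspace_scale[OF subspace_H])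
  also have "\<dots> = of_real ((cmod c)\<^sup>2 * Re (ip x x))"
    using ip_self_eq_of_real[OF assms]
    by (metis complex_norm_square of_real_mult)
  finally show ?thesis
    by (simp add: hnorm_def real_sqrt_mult)
qed

text \<open>Subtracting from \<open>x\<close> its orthogonal projection onto \<open>y\<close> leaves
  a vector \<open>z\<close> whose squared norm is nonnegative; written out, that is the
  claim.\<close>

lemma Cauchy_Schwarz:
  assumes x: "x \<in> H" and y: "y \<in> H"
  shows "cmod (ip x y) \<le> hnorm ip x * hnorm ip y"
proof (cases "y = 0")
  case True
  then show ?thesis
    using ip_zero_right[OF x] by (simp add: hnorm_zero)
next
  case False
  define n where "n = Re (ip y y)"
  have n: "0 < n" "ip y y = of_real n"
    using ip_pos[OF y False] ip_self_eq_of_real[OF y] by (simp_all add: n_def)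
  \<comment> \<open>The coefficient of the projection onto \<open>y\<close>, chosen to make
    \<open>z\<close> orthogonal to \<open>y\<close>.\<close>
  define c where "c = ip x y / of_real n"
  define z where "z = x - smul c y"
  have z: "z \<in> H"
    unfolding z_def by (intro subspace_diff subspace_scale subspace_H x y)
  have "ip z y = 0"
    using n by (simp add: z_def ip_diff_scale_left x y c_def)
  then have "ip y z = 0"
    using ip_cnj_sym[OF z y] by simp
  then have "ip z z = ip x z"
    using ip_diff_scale_left[OF x y z, of c] by (simp add: z_def)
  also have "\<dots> = cnj (ip z x)"
    by (rule ip_cnj_sym[OF z x])
  also have "ip z x = ip x x - c * cnj (ip x y)"
    using ip_cnj_sym[OF x y] by (simp add: z_def ip_diff_scale_left x y)
  also have "c * cnj (ip x y) = of_real ((cmod (ip x y))\<^sup>2 / n)"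
    by (simp add: c_def complex_norm_square del: of_real_power)
  finally have "Re (ip z z) = Re (ip x x) - (cmod (ip x y))\<^sup>2 / n"
    by simp
  then have "(cmod (ip x y))\<^sup>2 / n \<le> Re (ip x x)"
    using Re_ip_self_nonneg[OF z] by linarith
  then have "(cmod (ip x y))\<^sup>2 \<le> Re (ip x x) * n"
    using n(1) by (simp add: pos_divide_le_eq)
  then have "sqrt ((cmod (ip x y))\<^sup>2) \<le> sqrt (Re (ip x x) * n)"
    by (rule real_sqrt_le_mono)
  then show ?thesis
    by (simp add: hnorm_def n_def real_sqrt_mult)
qed

text \<open>Additivity of \<open>ip\<close> is known only on \<open>H\<close>, so the induction also
  has to keep the partial sums in \<open>H\<close>.\<close>

lemma cmod_ip_sum_le:
  fixes m :: nat
  assumes "\<And>i. i < m \<Longrightarrow> u i \<in> H" and S: "S \<in> H"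
  shows "cmod (ip (\<Sum>i<m. u i) S) \<le> (\<Sum>i<m. cmod (ip (u i) S))"
  using assms(1)
proof (induction m)
  case 0
  then show ?case using ip_zero_left[OF S] by simp
next
  case (Suc m)
  have "ip (\<Sum>i<Suc m. u i) S = ip (\<Sum>i<m. u i) S + ip (u m) S"
    using ip_add_left[OF subspace_sum[OF subspace_H, of "{..<m}" u] Suc.prems[of m] S] Suc.prems
    by simp
  then have "cmod (ip (\<Sum>i<Suc m. u i) S) \<le> cmod (ip (\<Sum>i<m. u i) S) + cmod (ip (u m) S)"
    by (simp add: norm_triangle_ineq)
  then show ?case
    using Suc by simp
qed

lemma cmod_ip_unit_le_spectral_norm:
  assumes P: "P \<subseteq> H" and S: "S \<in> H" and u: "u \<in> P" "hnorm ip u = 1"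
  shows "cmod (ip S u) \<le> spectral_norm ip P S"
proof -
  \<comment> \<open>A real \<open>Sup\<close> dominates its set only if that set is bounded;
    Cauchy-Schwarz supplies the bound \<open>hnorm ip S\<close>.\<close>
  have "bdd_above {cmod (ip S u) | u. u \<in> P \<and> hnorm ip u = 1}"
    using Cauchy_Schwarz[OF S] P by (intro bdd_aboveI[of _ "hnorm ip S"]) fastforce
  then show ?thesis
    unfolding spectral_norm_def using u by (intro cSup_upper) auto
qed

text \<open>Both sides are homogeneous in \<open>u\<close>, so a nonzero \<open>u\<close> can be
  rescaled to unit length; closure under scalars keeps it in \<open>P\<close>.\<close>

lemma cmod_ip_le_spectral_norm:
  assumes P: "P \<subseteq> H" and scale: "\<And>c x. x \<in> P \<Longrightarrow> smul c x \<in> P"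
    and S: "S \<in> H" and u: "u \<in> P"
  shows "cmod (ip S u) \<le> hnorm ip u * spectral_norm ip P S"
proof (cases "u = 0")
  case True
  then show ?thesis
    using ip_zero_right[OF S] by (simp add: hnorm_zero)
next
  case False
  have uH: "u \<in> H" using P u by blast
  define r where "r = hnorm ip u"
  have r: "0 < r" using hnorm_pos[OF uH False] by (simp add: r_def)
  define w where "w = smul (of_real (1 / r)) u"
  have "w \<in> P" "hnorm ip w = 1"
    using scale[OF u] r hnorm_scale[OF uH] by (simp_all add: w_def r_def norm_divide)
  then have "cmod (ip S w) \<le> spectral_norm ip P S"
    by (rule cmod_ip_unit_le_spectral_norm[OF P S])
  moreover have "cmod (ip S w) = cmod (ip S u) / r"
    using r by (simp add: w_def ip_scale_right S uH norm_mult norm_divide)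
  ultimately show ?thesis
    using r by (simp add: r_def field_simps)
qed

text \<open>The coefficients of a linear combination are absorbed into its vectors. This makes the
  set under the infimum of the nuclear norm nonempty.\<close>

lemma span_cone_decomposition:
  assumes scale: "\<And>c x. x \<in> P \<Longrightarrow> smul c x \<in> P" and "T \<in> span P"
  shows "\<exists>(m::nat) u. (\<forall>i<m. u i \<in> P) \<and> T = (\<Sum>i<m. u i)"
  using \<open>T \<in> span P\<close>
proof (induction rule: span_induct_alt)
  case base
  show ?case by (rule exI[of _ 0]) simp
next
  case (step c x y)
  then obtain m :: nat and u where u: "\<forall>i<m. u i \<in> P" "y = (\<Sum>i<m. u i)"
    by blast
  have "\<forall>i<Suc m. (u(m := smul c x)) i \<in> P"
    using u(1) scale[OF \<open>x \<in> P\<close>] by (simp add: less_Suc_eq)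
  moreover have "smul c x + y = (\<Sum>i<Suc m. (u(m := smul c x)) i)"
    using u(2) by (simp add: add.commute)
  ultimately show ?case by blast
qed

text \<open>The inequality for an arbitrary spanning cone \<open>P\<close>; of the pure tensors only
  these two properties enter.\<close>

lemma cmod_ip_le_nuclear_norm_spectral_norm:
  assumes span: "span P = H" and scale: "\<And>c x. x \<in> P \<Longrightarrow> smul c x \<in> P"
    and S: "S \<in> H" and T: "T \<in> H"
  shows "cmod (ip T S) \<le> nuclear_norm ip P T * spectral_norm ip P S"
proof -
  define N where
    "N = {(\<Sum>i<m. hnorm ip (u i)) | (m::nat) u. (\<forall>i<m. u i \<in> P) \<and> T = (\<Sum>i<m. u i)}"
  define s where "s = spectral_norm ip P S"
  have P: "P \<subseteq> H" using span span_superset by blast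
  have ne: "N \<noteq> {}"
    using span_cone_decomposition[of P T, OF scale] span T unfolding N_def by blast
  have nuc: "nuclear_norm ip P T = Inf N"
    by (simp add: N_def nuclear_norm_def)
  have bound: "cmod (ip T S) \<le> a * s" if aN: "a \<in> N" for a
  proof -
    obtain m :: nat and u where u: "\<And>i. i < m \<Longrightarrow> u i \<in> P"
      and Tu: "T = (\<Sum>i<m. u i)" and a: "a = (\<Sum>i<m. hnorm ip (u i))"
      using aN by (auto simp: N_def)
    have "cmod (ip T S) \<le> (\<Sum>i<m. cmod (ip (u i) S))"
      unfolding Tu using u P S by (intro cmod_ip_sum_le) auto
    also have "\<dots> \<le> (\<Sum>i<m. hnorm ip (u i) * s)"
    proof (intro sum_mono)
      fix i assume "i \<in> {..<m}"
      then have "u i \<in> P" using u by simp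
      \<comment> \<open>The spectral norm is defined with \<open>S\<close> in the first argument,
        hence the swap by \<open>cmod_ip_commute\<close>.\<close>
      then show "cmod (ip (u i) S) \<le> hnorm ip (u i) * s"
        using cmod_ip_le_spectral_norm[OF P scale S] cmod_ip_commute[of "u i" S] P S
        by (auto simp: s_def)
    qed
    finally show ?thesis by (simp add: a sum_distrib_right)
  qed
  have "cmod (ip T S) \<le> Inf N * s"
  \<comment> \<open>Without a unit vector in \<open>P\<close>, \<open>s\<close> is the
    \<open>Sup\<close> of the empty set and its sign is unknown.\<close>
  proof (cases "\<exists>u\<in>P. hnorm ip u = 1")
    case True
    then have "0 \<le> s"
      using cmod_ip_unit_le_spectral_norm[OF P S] norm_ge_zero order_trans
      unfolding s_def by blast
    \<comment> \<open>Passing to the infimum divides by \<open>s\<close>. For \<open>s = 0\<close>,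
      any single element of \<open>N\<close> already forces the left side to be 0.\<close>
    then consider "s = 0" | "0 < s" by linarith
    then show ?thesis
    proof cases
      case 1
      then show ?thesis using ne bound by auto
    next
      case 2
      then have "cmod (ip T S) / s \<le> Inf N"
        using bound by (intro cInf_greatest ne) (simp add: field_simps)
      then show ?thesis using 2 by (simp add: field_simps)
    qed
  next
    case False
    \<comment> \<open>An element of nonzero norm could be normalised within
      \<open>P\<close>.\<close>
    have P0: "hnorm ip u = 0" if "u \<in> P" for u
    proof (rule ccontr)
      assume "hnorm ip u \<noteq> 0"
      then have "u \<noteq> 0" using hnorm_zero by blast
      moreover have "u \<in> H" using P that by blast
      ultimately have "hnorm ip (smul (of_real (1 / hnorm ip u)) u) = 1"
        using hnorm_pos[of u] by (simp add: hnorm_scale norm_divide)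
      then show False using False scale[OF that] by blast
    qed
    have "a = 0" if "a \<in> N" for a
      using that P0 by (auto simp: N_def intro!: sum.neutral)
    \<comment> \<open>So \<open>Inf N\<close> is 0, and \<open>bound\<close> at 0 gives the claim
      whatever the value of \<open>s\<close>.\<close>
    then have "N = {0}" using ne by blast
    then show ?thesis using bound by simp
  qed
  then show ?thesis by (simp add: nuc s_def)
qed

end

text \<open>The scalar is absorbed into the first factor, which exists because
  \<open>d \<ge> 1\<close>; for \<open>d = 0\<close> there would be just one pure tensor.\<close>

lemma (in hilbert_tensor_product) pure_tensors_scale:
  assumes d: "d \<ge> 1" and x: "x \<in> pure_tensors d H tensor"
  shows "smulV c x \<in> pure_tensors d H tensor"
proof -
  obtain v where v: "v \<in> tuples d H" "x = tensor v"
    using x by (auto simp: pure_tensors_def)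
  have 1: "1 \<in> {1..d}" using d by simp
  interpret H1: fin_dim_hilbert smul "H 1" "ip 1"
    using factor_hilbert[OF 1] .
  have v1: "v 1 \<in> H 1"
    using v(1) 1 unfolding tuples_def by (rule PiE_mem)
  have "v(1 := smul c (v 1)) \<in> tuples d H"
    using v(1) v1 1 H1.subspace_scale[OF H1.subspace_H]
    by (auto simp: tuples_def PiE_iff extensional_def)
  moreover have "smulV c x = tensor (v(1 := smul c (v 1)))"
    \<comment> \<open>Homogeneity in slot 1 is applied at \<open>v 1\<close> itself, where
      \<open>v(1 := v 1)\<close> is \<open>v\<close>.\<close>
    using tensor_multilinear v v1 1 unfolding multilinear_on_def by (metis fun_upd_triv)
  ultimately show ?thesis
    unfolding pure_tensors_def by blast
qed

theorem corollary1p2: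
  fixes d :: nat
    and smul :: "complex \<Rightarrow> 'a::ab_group_add \<Rightarrow> 'a"
    and H :: "nat \<Rightarrow> 'a set"
    and ip :: "nat \<Rightarrow> 'a \<Rightarrow> 'a \<Rightarrow> complex"
    and smulV :: "complex \<Rightarrow> 'v::ab_group_add \<Rightarrow> 'v"
    and V :: "'v set"
    and ipV :: "'v \<Rightarrow> 'v \<Rightarrow> complex"
    and tensor :: "(nat \<Rightarrow> 'a) \<Rightarrow> 'v"
    and S T :: 'v
  assumes "d \<ge> 1"
    and "hilbert_tensor_product d smul H smulV V tensor ip ipV"
    and "S \<in> V" and "T \<in> V"
  shows "cmod (ipV T S) \<le>
    nuclear_norm ipV (pure_tensors d H tensor) T * spectral_norm ipV (pure_tensors d H tensor) S"
proof -
  interpret hilbert_tensor_product d smul H smulV V tensor ip ipV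
    by fact
  interpret V: fin_dim_hilbert smulV V ipV
    by (rule product_hilbert)
  show ?thesis
    \<comment> \<open>The pure tensors are a spanning cone of \<open>V\<close>, so the inequality
      for cones applies.\<close>
    using tensor_span pure_tensors_scale[OF \<open>d \<ge> 1\<close>] \<open>S \<in> V\<close> \<open>T \<in> V\<close>
    by (intro V.cmod_ip_le_nuclear_norm_spectral_norm) (simp_all add: pure_tensors_def)
qed

end
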